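(* Let $J$ be a complex structure on a $6$-dimensional nilpotent Lie algebra $\mathfrak{g}$ for which there is a basis $\{\omega^1,\omega^2,\omega^3\}$ of $\mathfrak{g}^{1,0}$ with $$d\omega^1=0,\qquad d\omega^2=\omega^{1\bar 1},\qquad d\omega^3=\rho\,\omega^{12}+B\,\omega^{1\bar 2}+C\,\omega^{2\bar 1},$$ where $\rho\in\{0,1\}$ and $B,C\in\mathbb{C}$ satisfy $(\rho,B,C)\neq(0,0,0)$. Then $\mathfrak{g}$ is $2$-step nilpotent if and only if $B=\rho=1$ and $C=0$. In such case $\mathfrak{g}$ is isomorphic to $\mathfrak{h}_7$ and all the complex structures are equivalent.
   Context: A complex structure on a real Lie algebra $\mathfrak{g}$ is an endomorphism $J$ with $J^2=-\mathrm{Id}$ and $[JX,JY]=J[JX,Y]+J[X,JY]+[X,Y]$ for all $X,Y$. $\mathfrak{g}^{1,0}\subset\mathfrak{g}_{\mathbb{C}}^*$ is the $i$-eigenspace of $J$ acting on $\mathfrak{g}_{\mathbb{C}}^*$; $d$ is the Chevalley–Eilenberg differential. Notation: $\omega^{jk}=\omega^j\wedge\omega^k$, $\omega^{j\bar k}=\omega^j\wedge\overline{\omega^k}$. Two complex structures $J,J'$ on $\mathfrak{g}$ are equivalent if there is a Lie algebra automorphism $F$ of $\mathfrak{g}$ with $J'=F^{-1}\circ J\circ F$. $\mathfrak{h}_7=(0,0,0,12,13,23)$, meaning the $6$-dimensional real Lie algebra whose dual has a basis $e^1,\dots,e^6$ with $de^1=de^2=de^3=0$, $de^4=e^1\wedge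 e^2$, $de^5=e^1\wedge e^3$, $de^6=e^2\wedge e^3$. *)

theory Defs
  imports "HOL-Analysis.Analysis" "HOL-Library.Function_Algebras"
begin

definition lie_bracket :: "('a::real_vector \<Rightarrow> 'a \<Rightarrow> 'a) \<Rightarrow> bool" where
  "lie_bracket br \<longleftrightarrow>
     bilinear br \<and> (\<forall>x. br x x = 0) \<and>
     (\<forall>x y z. br x (br y z) + br y (br z x) + br z (br x y) = 0)"

primrec lower_central :: "('a::real_vector \<Rightarrow> 'a \<Rightarrow> 'a) \<Rightarrow> nat \<Rightarrow> 'a set" where
  "lower_central br 0 = UNIV"
| "lower_central br (Suc k) = span {br x y | x y. y \<in> lower_central br k}"

definition nilpotent_lie :: "('a::real_vector \<Rightarrow> 'a \<Rightarrow> 'a) \<Rightarrow> bool" where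
  "nilpotent_lie br \<longleftrightarrow> (\<exists>k. lower_central br k = {0})"

definition step_nilpotent :: "nat \<Rightarrow> ('a::real_vector \<Rightarrow> 'a \<Rightarrow> 'a) \<Rightarrow> bool" where
  "step_nilpotent s br \<longleftrightarrow>
     lower_central br s = {0} \<and> (\<forall>k<s. lower_central br k \<noteq> {0})"

definition lie_iso ::
  "('a::real_vector \<Rightarrow> 'a \<Rightarrow> 'a) \<Rightarrow> ('b::real_vector \<Rightarrow> 'b \<Rightarrow> 'b) \<Rightarrow> ('a \<Rightarrow> 'b) \<Rightarrow> bool" where
  "lie_iso br br' F \<longleftrightarrow> linear F \<and> bij F \<and> (\<forall>x y. F (br x y) = br' (F x) (F y))"

definition lie_isomorphic ::
  "('a::real_vector \<Rightarrow> 'a \<Rightarrow> 'a) \<Rightarrow> ('b::real_vector \<Rightarrow> 'b \<Rightarrow> 'b) \<Rightarrow> bool" where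
  "lie_isomorphic br br' \<longleftrightarrow> (\<exists>F. lie_iso br br' F)"

definition complex_structure ::
  "('a::real_vector \<Rightarrow> 'a \<Rightarrow> 'a) \<Rightarrow> ('a \<Rightarrow> 'a) \<Rightarrow> bool" where
  "complex_structure br J \<longleftrightarrow>
     linear J \<and> (\<forall>x. J (J x) = - x) \<and>
     (\<forall>x y. br (J x) (J y) = J (br (J x) y) + J (br x (J y)) + br x y)"

definition equivalent_structures ::
  "('a::real_vector \<Rightarrow> 'a \<Rightarrow> 'a) \<Rightarrow> ('a \<Rightarrow> 'a) \<Rightarrow> ('a \<Rightarrow> 'a) \<Rightarrow> bool" where
  "equivalent_structures br J J' \<longleftrightarrow> (\<exists>F. lie_iso br br F \<and> J' = inv F \<circ> J \<circ> F)"

text \<open>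
  The dual of the complexification of a real vector space is identified with the space of
  its complex-valued real-linear forms, a complex vector space under pointwise operations.
  A 1-form is therefore a function into a field (real or complex), and a 2-form a function
  of two arguments.
\<close>

global_interpretation form: vector_space "\<lambda>(c::complex) (\<alpha>::'a \<Rightarrow> complex) x. c * \<alpha> x"
  by unfold_locales (auto simp: fun_eq_iff algebra_simps)

definition complex_dual :: "('a::real_vector \<Rightarrow> complex) set" where
  "complex_dual = {\<alpha>. linear \<alpha>}"

text \<open>
  \<open>J\<close> acts on forms by precomposition. With the opposite sign for the dual action, \<open>J\<close> is
  replaced by \<open>-J\<close>, which preserves both the notion of complex structure and equivalence.
\<close>

definition forms_10 :: "('a::real_vector \<Rightarrow> 'a) \<Rightarrow> ('a \<Rightarrow> complex) set" where
  "forms_10 J = {\<alpha> \<in> complex_dual. \<forall>x. \<alpha> (J x) = \<i> * \<alpha> x}"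

definition conj_form :: "('a \<Rightarrow> complex) \<Rightarrow> 'a \<Rightarrow> complex" where
  "conj_form \<alpha> = (\<lambda>x. cnj (\<alpha> x))"

definition wedge :: "('a \<Rightarrow> 'k::field) \<Rightarrow> ('a \<Rightarrow> 'k) \<Rightarrow> 'a \<Rightarrow> 'a \<Rightarrow> 'k" where
  "wedge \<alpha> \<beta> = (\<lambda>x y. \<alpha> x * \<beta> y - \<alpha> y * \<beta> x)"

definition ce_d :: "('a \<Rightarrow> 'a \<Rightarrow> 'a) \<Rightarrow> ('a \<Rightarrow> 'k::field) \<Rightarrow> 'a \<Rightarrow> 'a \<Rightarrow> 'k" where
  "ce_d br \<alpha> = (\<lambda>x y. - \<alpha> (br x y))"

text \<open>
  The brackets of \<open>\<frakh>\<^sub>7\<close> carry minus signs because \<open>d\<alpha>(x,y) = -\<alpha>([x,y])\<close>; the structure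
  equations \<open>(0,0,0,12,13,23)\<close> are checked below.
\<close>

definition h7 :: "real ^ 6 \<Rightarrow> real ^ 6 \<Rightarrow> real ^ 6" where
  "h7 x y = (\<chi> i. if i = 4 then - (x $ 1 * y $ 2 - y $ 1 * x $ 2)
                  else if i = 5 then - (x $ 1 * y $ 3 - y $ 1 * x $ 3)
                  else if i = 6 then - (x $ 2 * y $ 3 - y $ 2 * x $ 3)
                  else 0)"

lemma h7_structure_equations:
  defines "e \<equiv> \<lambda>i (x::real^6). x $ i"
  shows "ce_d h7 (e 1) = (\<lambda>x y. 0)" "ce_d h7 (e 2) = (\<lambda>x y. 0)" "ce_d h7 (e 3) = (\<lambda>x y. 0)"
    "ce_d h7 (e 4) = wedge (e 1) (e 2)"
    "ce_d h7 (e 5) = wedge (e 1) (e 3)"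
    "ce_d h7 (e 6) = wedge (e 2) (e 3)"
  by (auto simp: ce_d_def wedge_def h7_def e_def fun_eq_iff)

lemma lie_bracket_h7: "lie_bracket h7"
  unfolding lie_bracket_def bilinear_def
  by (auto intro!: linearI simp: h7_def vec_eq_iff algebra_simps)

end

theory Submission
  imports Defs "HOL-Analysis.Cross3"
begin

text \<open>
  In the coframe, \<open>d\<omega>\<^sup>3\<close> evaluated on \<open>x\<close> and \<open>u = [y, z]\<close> equals
  \<open>((\<rho> - B) \<omega>\<^sup>1(x) - C cnj (\<omega>\<^sup>1(x))) \<omega>\<^sup>2(u)\<close>, because \<open>\<omega>\<^sup>1(u) = 0\<close> and \<open>\<omega>\<^sup>2(u)\<close> is
  imaginary; this is the whole content of the 2-step criterion.

  For the uniqueness, \<open>\<frakh>\<^sub>7\<close> is the free 2-step nilpotent algebra on three generators, modelled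
  as \<open>V \<times> V\<close> with \<open>V = \<real>\<^sup>3\<close> and bracket \<open>(0, v \<times> v')\<close>. If \<open>Z = 0 \<times> V\<close> is the centre,
  integrability gives \<open>[JZ, JZ] = 0\<close>, so \<open>JZ\<close> is at most a line modulo \<open>Z\<close>, and \<open>Z\<close> is not
  \<open>J\<close>-invariant since its dimension is odd. This yields generators \<open>X, JX, Y\<close> which can be
  adjusted to satisfy \<open>JY = [X, JX]\<close>. Integrability then forces \<open>J[X, Y] = [JX, Y]\<close>, so \<open>J\<close> has the
  same matrix in every such frame, and any two frames are related by an automorphism.
\<close>

unbundle cross3_syntax

section \<open>Two-step nilpotency, and transport along Lie isomorphisms\<close>

text \<open>The kernel of \<open>br x\<close> is a subspace, so vanishing on a span of brackets can
  be tested on single brackets. This turns the lower central series into identities that a coframe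
  can evaluate.\<close>

lemma step_nilpotent_2_iff:
  assumes "bilinear br"
  shows "step_nilpotent 2 br \<longleftrightarrow> (\<forall>x y z. br x (br y z) = 0) \<and> (\<exists>x y. br x y \<noteq> 0)"
proof -
  have r0: "br x 0 = 0" for x
    using assms by (rule bilinear_rzero)
  have span0: "span S = {0} \<longleftrightarrow> S \<subseteq> {0}" for S :: "'a set"
    using span_superset[of S] span_mono[of S "{0}"] span_zero[of S]
    by (auto simp: span_insert_0)
  have l1: "lower_central br 1 = {0} \<longleftrightarrow> (\<forall>x y. br x y = 0)"
    by (auto simp: span0)
  have "lower_central br 2 = {0} \<longleftrightarrow> (\<forall>x. \<forall>y \<in> span {br u v | u v. True}. br x y = 0)"
    by (auto simp: span0 numeral_2_eq_2)
  also have "\<dots> \<longleftrightarrow> (\<forall>x y z. br x (br y z) = 0)"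
  proof
    assume *: "\<forall>x y z. br x (br y z) = 0"
    have "span {br u v | u v. True} \<subseteq> {y. br x y = 0}" for x
      using assms * by (intro span_minimal linear_subspace_kernel) (auto simp: bilinear_def)
    then show "\<forall>x. \<forall>y \<in> span {br u v | u v. True}. br x y = 0"
      by blast
  qed (blast intro: span_base)
  finally have l2: "lower_central br 2 = {0} \<longleftrightarrow> (\<forall>x y z. br x (br y z) = 0)" .
  have l0: "lower_central br 0 \<noteq> {0}" if "br x y \<noteq> 0" for x y
    using that r0 by auto
  show ?thesis
    unfolding step_nilpotent_def l2 using l0 l1 by (auto simp: less_2_cases_iff)
qed

lemma lie_iso_compose: "lie_iso b1 b2 F \<Longrightarrow> lie_iso b2 b3 G \<Longrightarrow> lie_iso b1 b3 (G \<circ> F)"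
  by (auto simp: lie_iso_def linear_compose bij_comp)

lemma lie_iso_inv:
  assumes "lie_iso b1 b2 F"
  shows "lie_iso b2 b1 (inv F)"
proof -
  have F: "linear F" "bij F" and br: "\<And>x y. F (b1 x y) = b2 (F x) (F y)"
    using assms by (auto simp: lie_iso_def)
  have inv: "F (inv F y) = y" "inv F (F x) = x" for x y
    using F(2) by (simp_all add: bij_is_surj bij_is_inj surj_f_inv_f)
  then have "inv F (b2 x y) = b1 (inv F x) (inv F y)" for x y
    by (metis br)
  moreover have "linear (inv F)"
  proof (rule linearI)
    fix x y and c :: real
    have "inv F (x + y) = inv F (F (inv F x + inv F y))"
      by (simp only: linear_add[OF F(1)] inv)
    then show "inv F (x + y) = inv F x + inv F y"
      by (simp only: inv)
    have "inv F (c *\<^sub>R x) = inv F (F (c *\<^sub>R inv F x))"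
      by (simp only: linear_scale[OF F(1)] inv)
    then show "inv F (c *\<^sub>R x) = c *\<^sub>R inv F x"
      by (simp only: inv)
  qed
  ultimately show ?thesis
    using F(2) by (simp add: lie_iso_def bij_imp_bij_inv)
qed

lemma complex_structure_transport:
  assumes iso: "lie_iso b1 b2 F" and J: "complex_structure b1 J"
  shows "complex_structure b2 (F \<circ> J \<circ> inv F)"
proof -
  have lins: "linear F" "linear (inv F)" "linear J" and "bij F"
    using iso lie_iso_inv[OF iso] J by (auto simp: lie_iso_def complex_structure_def)
  have inv: "F (inv F y) = y" "inv F (F x) = x" for x y
    using \<open>bij F\<close> by (simp_all add: bij_is_surj bij_is_inj surj_f_inv_f)
  have br: "b2 (F x) (F y) = F (b1 x y)" for x y
    using iso by (simp add: lie_iso_def)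
  let ?K = "F \<circ> J \<circ> inv F"
  have K: "?K (F x) = F (J x)" for x
    by (simp add: inv)
  have "b2 (?K x) (?K y) = ?K (b2 (?K x) y) + ?K (b2 x (?K y)) + b2 x y" for x y
  proof -
    obtain u v where uv: "x = F u" "y = F v"
      using inv by metis
    have "b1 (J u) (J v) = J (b1 (J u) v) + J (b1 u (J v)) + b1 u v"
      using J unfolding complex_structure_def by blast
    then show ?thesis
      unfolding uv K br by (simp only: linear_add[OF lins(1)])
  qed
  moreover have "?K (?K x) = - x" for x
  proof -
    have "J (J (inv F x)) = - inv F x"
      using J unfolding complex_structure_def by blast
    then show ?thesis
      by (simp add: inv linear_neg[OF lins(1)])
  qed
  moreover have "linear ?K"
    using lins by (intro linear_compose)
  ultimately show ?thesis
    unfolding complex_structure_def by blast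
qed

text \<open>Conjugating an automorphism of the target by \<open>F\<close> gives one of the source,
  so uniqueness only has to be proved on a model algebra.\<close>

lemma equivalent_structures_transport:
  assumes iso: "lie_iso b1 b2 F"
    and eq: "equivalent_structures b2 (F \<circ> J1 \<circ> inv F) (F \<circ> J2 \<circ> inv F)"
  shows "equivalent_structures b1 J1 J2"
proof -
  obtain G where G: "lie_iso b2 b2 G" "F \<circ> J2 \<circ> inv F = inv G \<circ> (F \<circ> J1 \<circ> inv F) \<circ> G"
    using eq by (auto simp: equivalent_structures_def)
  have "bij F" "bij G"
    using iso G(1) by (auto simp: lie_iso_def)
  have inv: "F (inv F y) = y" "inv F (F x) = x" for x y
    using \<open>bij F\<close> by (simp_all add: bij_is_surj bij_is_inj surj_f_inv_f)
  define H where "H = inv F \<circ> (G \<circ> F)"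
  have "lie_iso b1 b1 H"
    unfolding H_def by (rule lie_iso_compose[OF lie_iso_compose[OF iso G(1)] lie_iso_inv[OF iso]])
  moreover have "inv H = inv F \<circ> inv G \<circ> F"
    unfolding H_def using \<open>bij F\<close> \<open>bij G\<close>
    by (simp add: o_inv_distrib bij_comp bij_imp_bij_inv inv_inv_eq comp_assoc)
  then have "inv H \<circ> J1 \<circ> H = inv F \<circ> (inv G \<circ> (F \<circ> J1 \<circ> inv F) \<circ> G) \<circ> F"
    by (simp add: H_def comp_assoc)
  then have "J2 = inv H \<circ> J1 \<circ> H"
    unfolding G(2)[symmetric] by (simp add: fun_eq_iff inv)
  ultimately show ?thesis
    by (auto simp: equivalent_structures_def)
qed

section \<open>The cross product model and its identification with \<open>h7\<close>\<close>

definition cross_bracket :: "(real^3) \<times> (real^3) \<Rightarrow> (real^3) \<times> (real^3) \<Rightarrow> (real^3) \<times> (real^3)" where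
  "cross_bracket x y = (0, fst x \<times> fst y)"

text \<open>
  For the standard basis \<open>e\<^sub>i = (e\<^sub>i, 0)\<close> this is
  \<open>J e\<^sub>1 = e\<^sub>2\<close>, \<open>J e\<^sub>3 = [e\<^sub>1, e\<^sub>2]\<close>, \<open>J [e\<^sub>1, e\<^sub>3] = [e\<^sub>2, e\<^sub>3]\<close>.
\<close>

definition cross_J :: "(real^3) \<times> (real^3) \<Rightarrow> (real^3) \<times> (real^3)" where
  "cross_J x =
    (vector [- fst x $ 2, fst x $ 1, - snd x $ 3], vector [- snd x $ 2, snd x $ 1, fst x $ 3])"

text \<open>Cross product components are ordered \<open>23\<close>, \<open>31\<close>,
  \<open>12\<close>, whereas \<open>h7\<close> has minus \<open>12\<close>, \<open>13\<close>,
  \<open>23\<close> in coordinates 4, 5, 6. Hence the reversed order, with a sign in coordinates 4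
  and 6 only.\<close>

definition cross_to_h7 :: "(real^3) \<times> (real^3) \<Rightarrow> real^6" where
  "cross_to_h7 x = (\<chi> i. if i = 1 then fst x $ 1 else if i = 2 then fst x $ 2 else if i = 3 then fst x $ 3
      else if i = 4 then - snd x $ 3 else if i = 5 then snd x $ 2 else if i = 6 then - snd x $ 1 else 0)"

lemma lie_iso_cross_to_h7: "lie_iso cross_bracket h7 cross_to_h7"
proof -
  have lin: "linear cross_to_h7"
    by (auto intro!: linearI simp: cross_to_h7_def vec_eq_iff)
  have inj: "inj cross_to_h7"
  proof (rule injI)
    fix x y assume "cross_to_h7 x = cross_to_h7 y"
    then have *: "cross_to_h7 x $ i = cross_to_h7 y $ i" for i by simp
    show "x = y"
      using *[of 1] *[of 2] *[of 3] *[of 4] *[of 5] *[of 6]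
      by (simp add: prod_eq_iff vec_eq_iff forall_3 cross_to_h7_def)
  qed
  have "surj cross_to_h7"
    using lin inj by (rule linear_injective_imp_surjective) (simp add: dim_UNIV)
  moreover have "cross_to_h7 (cross_bracket x y) = h7 (cross_to_h7 x) (cross_to_h7 y)" for x y
    by (auto simp: cross_to_h7_def cross_bracket_def cross3_def h7_def vec_eq_iff)
  ultimately show ?thesis
    using lin inj by (auto simp: lie_iso_def bij_def)
qed

section \<open>Linear algebra in real 3-space\<close>

text \<open>In odd dimension minus the identity has determinant -1, which is not the square of a
  real number.\<close>

lemma no_complex_structure_3:
  fixes K :: "real^3 \<Rightarrow> real^3"
  assumes "linear K"
  shows "\<exists>x. K (K x) \<noteq> - x"
proof (rule ccontr)
  assume "\<not> ?thesis"
  then have "K \<circ> K = uminus"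
    by auto
  then have "matrix K ** matrix K = matrix (uminus :: real^3 \<Rightarrow> _)"
    using matrix_compose[OF assms assms] by simp
  then have "det (matrix K) * det (matrix K) = det (matrix (uminus :: real^3 \<Rightarrow> _))"
    by (simp flip: det_mul)
  also have "\<dots> = -1"
    by (simp add: det_3 matrix_def axis_def)
  finally show False
    using zero_le_square[of "det (matrix K)"] by linarith
qed

text \<open>Pairing the relation with each of the three pairwise cross products isolates one
  coefficient.\<close>

lemma dot_cross_independent:
  fixes u v w :: "real^3"
  assumes "u \<bullet> (v \<times> w) \<noteq> 0" "a *\<^sub>R u + b *\<^sub>R v + c *\<^sub>R w = 0"
  shows "a = 0 \<and> b = 0 \<and> c = 0"
proof -
  let ?s = "a *\<^sub>R u + b *\<^sub>R v + c *\<^sub>R w"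
  have "?s \<bullet> (v \<times> w) = a * (u \<bullet> (v \<times> w))" "?s \<bullet> (w \<times> u) = b * (u \<bullet> (v \<times> w))"
    "?s \<bullet> (u \<times> v) = c * (u \<bullet> (v \<times> w))"
    by (simp_all add: cross3_simps)
  then show ?thesis
    unfolding assms(2) using assms(1) by simp
qed

lemma parallel_of_cross_eq_0:
  fixes u v :: "real^3"
  assumes "u \<times> v = 0" "v \<noteq> 0"
  obtains c where "u = c *\<^sub>R v"
proof -
  have "collinear {0, v, u}"
    using assms(1) by (simp add: cross_eq_0 insert_commute[of v u])
  then show ?thesis
    using assms(2) that[of 0] that by (auto simp: collinear_lemma)
qed

section \<open>Normal form of complex structures on the model\<close>

lemma cross_complex_structure_frame:
  assumes "complex_structure cross_bracket J"
  obtains X Y where "J Y = (0, fst X \<times> fst (J X))" "fst X \<bullet> (fst (J X) \<times> fst Y) \<noteq> 0"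
proof -
  have lin: "linear J" and JJ: "\<And>x. J (J x) = - x"
    using assms unfolding complex_structure_def by blast+
  have N: "(0, fst (J x) \<times> fst (J y)) =
        J (0, fst (J x) \<times> fst y) + J (0, fst x \<times> fst (J y)) + (0, fst x \<times> fst y)" for x y
    using assms[unfolded complex_structure_def cross_bracket_def, THEN conjunct2, THEN conjunct2,
      THEN spec, THEN spec] .
  note J_simps = linear_0[OF lin] linear_add[OF lin] linear_diff[OF lin] linear_neg[OF lin]
    linear_scale[OF lin]
  have J_pair: "J (a, b) = J (a, 0) + J (0, b)" for a b
    using linear_add[OF lin, of "(a, 0)" "(0, b)"] by simp
  \<comment> \<open>Blocks of \<open>J\<close>: \<open>P\<close> maps the centre to the quotient by
    the centre, and \<open>A\<close> is the induced block on the quotient.\<close>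
  define P where "P w = fst (J (0, w))" for w
  define A where "A v = fst (J (v, 0))" for v
  have "linear (\<lambda>w. (0::real^3, w::real^3))" "linear (\<lambda>v. (v::real^3, 0::real^3))"
    by (auto intro!: linearI)
  from this[THEN linear_compose, OF lin]
  have lin_P: "linear P" and lin_A: "linear A" and lin_K: "linear (\<lambda>w. snd (J (0, w)))"
    unfolding P_def[abs_def] A_def[abs_def]
    using linear_compose[OF _ linear_fst] linear_compose[OF _ linear_snd] by (auto simp: o_def)
  \<comment> \<open>Integrability at two central vectors: every other term is a bracket with a
    central entry, so the image of \<open>P\<close> is at most a line.\<close>
  have PP: "P w \<times> P w' = 0" for w w'
    using N[of "(0, w)" "(0, w')"] by (simp add: P_def J_simps flip: zero_prod_def) (simp add: zero_prod_def)
  \<comment> \<open>If \<open>P\<close> vanished, \<open>J\<close> would restrict to a complex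
    structure on the 3-dimensional centre.\<close>
  obtain w0 where w0: "P w0 \<noteq> 0"
  proof (rule ccontr)
    assume "\<not> thesis"
    then have "fst (J (0, w)) = 0" for w
      using that by (auto simp: P_def)
    then have "J (0, w) = (0, snd (J (0, w)))" for w
      by (simp add: prod_eq_iff)
    then have "snd (J (0, snd (J (0, w)))) = - w" for w
      by (metis JJ snd_conv snd_uminus)
    then show False
      using no_complex_structure_3[OF lin_K] by blast
  qed
  \<comment> \<open>A vector outside the centre with \<open>J Z\<close> central; \<open>v3\<close>
    spans the image of \<open>P\<close>.\<close>
  define Z where "Z = - J (0, w0)"
  define v3 where "v3 = fst Z"
  have v3: "v3 = - P w0" "v3 \<noteq> 0"
    using w0 by (auto simp: v3_def Z_def P_def)
  have JZ: "J Z = (0, w0)"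
    by (simp add: Z_def J_simps JJ)
  have P_v3: "P w \<times> v3 = 0" for w
    by (simp add: v3 PP)
  obtain v1 where n: "v1 \<times> v3 \<noteq> 0"
    using cross_basis_nonzero[OF v3(2)] by (metis cross_skew neg_equal_0_iff_equal)
  define v2 where "v2 = A v1"
  \<comment> \<open>\<open>(v3, 0)\<close> differs from \<open>Z\<close> by a central vector and
    \<open>P\<close> takes values in the line of \<open>v3\<close>, so \<open>A\<close> preserves
    this line.\<close>
  have A_v3: "A v3 \<times> v3 = 0"
  proof -
    have "(v3, 0) = Z - (0, snd Z)"
      by (simp add: v3_def prod_eq_iff)
    then have "J (v3, 0) = J Z - J (0, snd Z)"
      by (simp only: J_simps)
    then show ?thesis
      by (simp add: A_def JZ P_v3 flip: P_def)
  qed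
  have AA: "A (A v) \<times> v3 = - (v \<times> v3)" for v
  proof -
    have "A (A v) + P (snd (J (v, 0))) = - v"
      using JJ[of "(v, 0)"] J_pair[of "fst (J (v, 0))" "snd (J (v, 0))"]
      by (simp add: A_def P_def prod_eq_iff)
    then have "A (A v) = - v - P (snd (J (v, 0)))"
      by (simp add: algebra_simps)
    then show ?thesis
      by (simp add: Cross3.left_diff_distrib P_v3)
  qed
  \<comment> \<open>Modulo \<open>v3\<close>, \<open>A\<close> squares to \<open>-1\<close>, hence it has no real eigenvector.\<close>
  have D: "v1 \<bullet> (v2 \<times> v3) \<noteq> 0"
  proof
    assume D: "v1 \<bullet> (v2 \<times> v3) = 0"
    have "(v2 \<times> v3) \<times> (v1 \<times> v3) = - (v1 \<bullet> (v2 \<times> v3)) *\<^sub>R v3"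
      by (simp add: cross3_def inner_vec_def sum_3 vec_eq_iff forall_3 algebra_simps)
    then have "(v2 \<times> v3) \<times> (v1 \<times> v3) = 0"
      using D by simp
    then obtain c where c: "v2 \<times> v3 = c *\<^sub>R (v1 \<times> v3)"
      using parallel_of_cross_eq_0[OF _ n] by blast
    then have "(v2 - c *\<^sub>R v1) \<times> v3 = 0"
      by (simp add: Cross3.left_diff_distrib cross_mult_left)
    then obtain d where "v2 - c *\<^sub>R v1 = d *\<^sub>R v3"
      using parallel_of_cross_eq_0[OF _ v3(2)] by blast
    then have "v2 = c *\<^sub>R v1 + d *\<^sub>R v3"
      by (simp add: algebra_simps)
    then have "A v2 \<times> v3 = c *\<^sub>R (v2 \<times> v3)"
      using A_v3 by (simp add: linear_add[OF lin_A] linear_scale[OF lin_A] cross_add_left cross_mult_left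
          flip: v2_def)
    then have "(1 + c * c) *\<^sub>R (v1 \<times> v3) = 0"
      using AA[of v1] c by (simp add: algebra_simps flip: v2_def)
    then show False
      using n by (simp add: add_nonneg_eq_0_iff)
  qed
  \<comment> \<open>As \<open>J Z\<close> is central, both brackets containing it drop out of
    integrability at \<open>(v1, 0)\<close> and \<open>Z\<close>.\<close>
  have "J (0, v2 \<times> v3) + (0, v1 \<times> v3) = 0"
    using N[of "(v1, 0)" Z] by (simp add: JZ J_simps flip: A_def v2_def v3_def zero_prod_def)
  then have J3: "J (0, v2 \<times> v3) = - (0, v1 \<times> v3)"
    by (simp only: eq_neg_iff_add_eq_0)
  then have J2: "J (0, v1 \<times> v3) = (0, v2 \<times> v3)"
    using JJ[of "(0, v2 \<times> v3)"] by (simp only: J_simps neg_equal_iff_equal)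
  \<comment> \<open>Cramer coefficients of \<open>w0\<close> in the basis of pairwise cross
    products, whose dual basis is \<open>v3\<close>, \<open>- v2\<close>, \<open>v1\<close> up to
    the determinant.\<close>
  define \<alpha> \<beta> \<gamma> where "\<alpha> = (w0 \<bullet> v3) / (v1 \<bullet> (v2 \<times> v3))" "\<beta> = - (w0 \<bullet> v2) / (v1 \<bullet> (v2 \<times> v3))"
    "\<gamma> = (w0 \<bullet> v1) / (v1 \<bullet> (v2 \<times> v3))"
  have "(v1 \<bullet> (v2 \<times> v3)) *\<^sub>R w0 = (w0 \<bullet> v3) *\<^sub>R (v1 \<times> v2) - (w0 \<bullet> v2) *\<^sub>R (v1 \<times> v3) + (w0 \<bullet> v1) *\<^sub>R (v2 \<times> v3)"
    unfolding cross3_def inner_vec_def sum_3 vec_eq_iff forall_3 by (simp add: algebra_simps)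
  then have "(1 / (v1 \<bullet> (v2 \<times> v3))) *\<^sub>R ((v1 \<bullet> (v2 \<times> v3)) *\<^sub>R w0) =
      (1 / (v1 \<bullet> (v2 \<times> v3))) *\<^sub>R
        ((w0 \<bullet> v3) *\<^sub>R (v1 \<times> v2) - (w0 \<bullet> v2) *\<^sub>R (v1 \<times> v3) + (w0 \<bullet> v1) *\<^sub>R (v2 \<times> v3))"
    by (rule arg_cong)
  then have w0_eq: "w0 = \<alpha> *\<^sub>R (v1 \<times> v2) + \<beta> *\<^sub>R (v1 \<times> v3) + \<gamma> *\<^sub>R (v2 \<times> v3)"
    using D by (simp add: \<alpha>_\<beta>_\<gamma>_def scaleR_add_right scaleR_diff_right)
  \<comment> \<open>Otherwise \<open>w0\<close> lies in the span of \<open>v1 \<times> v3\<close>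
    and \<open>v2 \<times> v3\<close>, which \<open>J\<close> keeps inside the centre, so
    \<open>P w0 = 0\<close>.\<close>
  have "\<alpha> \<noteq> 0"
  proof
    assume "\<alpha> = 0"
    then have "P w0 = \<beta> *\<^sub>R P (v1 \<times> v3) + \<gamma> *\<^sub>R P (v2 \<times> v3)"
      by (metis w0_eq add_0 scaleR_zero_left linear_add[OF lin_P] linear_scale[OF lin_P])
    also have "\<dots> = 0"
      by (simp add: P_def J2 J3)
    finally show False
      using w0 by simp
  qed
  \<comment> \<open>The central correction cancels the \<beta> and \<gamma> terms of
    \<open>w0\<close> in \<open>J Y\<close>; scaling then normalizes the coefficient of
    \<open>v1 \<times> v2\<close> to 1.\<close>
  define Y where "Y = (1 / \<alpha>) *\<^sub>R (Z + (0, \<beta> *\<^sub>R (v2 \<times> v3) - \<gamma> *\<^sub>R (v1 \<times> v3)))"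
  have "(0, \<beta> *\<^sub>R (v2 \<times> v3) - \<gamma> *\<^sub>R (v1 \<times> v3)) = \<beta> *\<^sub>R (0, v2 \<times> v3) - \<gamma> *\<^sub>R (0 :: real^3, v1 \<times> v3)"
    by simp
  then have "J Y = (1 / \<alpha>) *\<^sub>R ((0, w0) - \<beta> *\<^sub>R (0, v1 \<times> v3) - \<gamma> *\<^sub>R (0, v2 \<times> v3))"
    by (simp only: Y_def J_simps JZ J2 J3) simp
  also have "\<dots> = (0, v1 \<times> v2)"
    using \<open>\<alpha> \<noteq> 0\<close> by (subst w0_eq) simp
  finally have "J Y = (0, v1 \<times> v2)" .
  moreover have "fst Y = (1 / \<alpha>) *\<^sub>R v3"
    by (simp add: Y_def v3_def)
  ultimately show ?thesis
    using that[of Y "(v1, 0)"] D \<open>\<alpha> \<noteq> 0\<close>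
    by (simp add: cross_mult_right flip: A_def v2_def)
qed

text \<open>By freeness, the standard generators can be sent to \<open>X\<close>,
  \<open>J X\<close>, \<open>Y\<close>, and this extends to an automorphism. Integrability forces
  the values of \<open>J\<close> on the frame and its brackets to be those of
  \<open>cross_J\<close>.\<close>

lemma cross_complex_structure_normal_form:
  assumes "complex_structure cross_bracket J"
  obtains T where "lie_iso cross_bracket cross_bracket T" "J \<circ> T = T \<circ> cross_J"
proof -
  have lin: "linear J" and JJ: "\<And>x. J (J x) = - x"
    using assms unfolding complex_structure_def by blast+
  have N: "(0, fst (J x) \<times> fst (J y)) =
        J (0, fst (J x) \<times> fst y) + J (0, fst x \<times> fst (J y)) + (0, fst x \<times> fst y)" for x y
    using assms[unfolded complex_structure_def cross_bracket_def, THEN conjunct2, THEN conjunct2,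
      THEN spec, THEN spec] .
  note J_simps = linear_0[OF lin] linear_add[OF lin] linear_diff[OF lin] linear_neg[OF lin]
    linear_scale[OF lin]
  obtain X Y where XY: "J Y = (0, fst X \<times> fst (J X))" "fst X \<bullet> (fst (J X) \<times> fst Y) \<noteq> 0"
    using cross_complex_structure_frame[OF assms] .
  define v1 v2 v3 where v: "v1 = fst X" "v2 = fst (J X)" "v3 = fst Y"
  note XY = XY[folded v]
  have J1: "J (0, v1 \<times> v2) = - Y"
    using JJ[of Y] XY(1) by simp
  have "J (0, v2 \<times> v3) + (0, v1 \<times> v3) = 0"
    using N[of X Y] by (simp add: XY(1) J_simps flip: v zero_prod_def)
  then have J3: "J (0, v2 \<times> v3) = - (0, v1 \<times> v3)"
    by (simp only: eq_neg_iff_add_eq_0)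
  then have J2: "J (0, v1 \<times> v3) = (0, v2 \<times> v3)"
    using JJ[of "(0, v2 \<times> v3)"] by (simp only: J_simps neg_equal_iff_equal)
  \<comment> \<open>The second component of the model has basis \<open>e1 \<times> e2\<close>,
    \<open>- (e1 \<times> e3)\<close>, \<open>e2 \<times> e3\<close> in coordinates 3, 2, 1, which
    gives the signs.\<close>
  define T where "T x = fst x $ 1 *\<^sub>R X + fst x $ 2 *\<^sub>R J X + fst x $ 3 *\<^sub>R Y
      + (snd x $ 3 *\<^sub>R (0, v1 \<times> v2) - snd x $ 2 *\<^sub>R (0, v1 \<times> v3) + snd x $ 1 *\<^sub>R (0, v2 \<times> v3))" for x :: "(real^3) \<times> (real^3)"
  have fst_T: "fst (T x) = fst x $ 1 *\<^sub>R v1 + fst x $ 2 *\<^sub>R v2 + fst x $ 3 *\<^sub>R v3" for x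
    by (simp add: T_def v)
  have lin_T: "linear T"
    by (rule linearI) (simp_all add: T_def algebra_simps)
  have "inj T"
    unfolding linear_injective_0[OF lin_T]
  proof (intro allI impI)
    fix x assume T0: "T x = 0"
    then have a: "fst x $ 1 = 0 \<and> fst x $ 2 = 0 \<and> fst x $ 3 = 0"
      using dot_cross_independent[OF XY(2)] fst_T[of x] by (metis fst_zero)
    with T0 have "snd x $ 1 *\<^sub>R (v2 \<times> v3) + snd x $ 2 *\<^sub>R (v3 \<times> v1) + snd x $ 3 *\<^sub>R (v1 \<times> v2) = 0"
      by (simp add: T_def prod_eq_iff cross_skew[of v3 v1] algebra_simps)
    \<comment> \<open>The determinant of the pairwise cross products is the squared determinant of
      the frame, so the brackets are independent too.\<close>
    moreover have "(v2 \<times> v3) \<bullet> ((v3 \<times> v1) \<times> (v1 \<times> v2)) = (v1 \<bullet> (v2 \<times> v3))\<^sup>2"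
      by (simp add: cross_cross_det cross3_simps power2_eq_square)
    ultimately have "snd x $ 1 = 0 \<and> snd x $ 2 = 0 \<and> snd x $ 3 = 0"
      using XY(2) by (intro dot_cross_independent) auto
    with a show "x = 0"
      by (simp add: prod_eq_iff vec_eq_iff forall_3)
  qed
  then have "bij T"
    using lin_T linear_injective_imp_surjective[OF lin_T] by (simp add: bij_def)
  moreover have "T (cross_bracket x y) = cross_bracket (T x) (T y)" for x y
    unfolding cross_bracket_def fst_T
    by (simp add: T_def cross_add_left cross_add_right cross_mult_left cross_mult_right
        cross_skew[of v2 v1] cross_skew[of v3 v1] cross_skew[of v3 v2])
      (simp add: cross3_def algebra_simps)
  moreover have "J \<circ> T = T \<circ> cross_J"
  proof
    fix x
    show "(J \<circ> T) x = (T \<circ> cross_J) x"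
      unfolding comp_apply T_def J_simps J1 J2 J3 XY(1) JJ by (simp add: cross_J_def)
  qed
  ultimately show ?thesis
    using that lin_T unfolding lie_iso_def by blast
qed

lemma equivalent_structures_cross_bracket:
  assumes "complex_structure cross_bracket J1" "complex_structure cross_bracket J2"
  shows "equivalent_structures cross_bracket J1 J2"
proof -
  obtain S where S: "lie_iso cross_bracket cross_bracket S" "J1 \<circ> S = S \<circ> cross_J"
    using cross_complex_structure_normal_form[OF assms(1)] .
  obtain T where T: "lie_iso cross_bracket cross_bracket T" "J2 \<circ> T = T \<circ> cross_J"
    using cross_complex_structure_normal_form[OF assms(2)] .
  have "bij S" "bij T"
    using S T by (auto simp: lie_iso_def)
  then have inv: "S (inv S x) = x" "inv S (S x) = x" "T (inv T x) = x" "inv T (T x) = x" for x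
    by (simp_all add: bij_is_surj bij_is_inj surj_f_inv_f)
  have "inv (S \<circ> inv T) = T \<circ> inv S"
    using \<open>bij S\<close> \<open>bij T\<close> by (simp add: o_inv_distrib bij_imp_bij_inv inv_inv_eq)
  moreover have "J1 (S x) = S (cross_J x)" "J2 (T x) = T (cross_J x)" for x
    using S(2) T(2) by (metis comp_apply)+
  then have "J2 x = T (inv S (J1 (S (inv T x))))" for x
    by (metis inv)
  then have "J2 = (T \<circ> inv S) \<circ> J1 \<circ> (S \<circ> inv T)"
    by (simp add: fun_eq_iff del: split_paired_All)
  ultimately have "J2 = inv (S \<circ> inv T) \<circ> J1 \<circ> (S \<circ> inv T)"
    by simp
  moreover have "lie_iso cross_bracket cross_bracket (S \<circ> inv T)"
    by (rule lie_iso_compose[OF lie_iso_inv[OF T(1)] S(1)])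
  ultimately show ?thesis
    by (auto simp: equivalent_structures_def)
qed

section \<open>Real coordinates from a coframe of (1,0)-forms\<close>

lemma bij_of_inj_linear_dim_eq:
  fixes f :: "'a::real_vector \<Rightarrow> 'b::euclidean_space"
  assumes "linear f" "inj f" "dim (UNIV :: 'a set) = DIM('b)"
  shows "bij f"
proof -
  obtain B :: "'a set" where B: "independent B" "card B = DIM('b)"
    using basis_exists[of "UNIV :: 'a set"] assms(3) by metis
  have "independent (f ` B)" "card (f ` B) = DIM('b)"
    using B assms(1,2) by (simp_all add: linear_independent_injective_image card_image inj_on_subset)
  then have "span (f ` B) = UNIV"
    using card_ge_dim_independent[of "f ` B" UNIV] by auto
  moreover have "span (f ` B) \<subseteq> range f"
    by (intro span_minimal linear_subspace_image[OF assms(1)]) auto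
  ultimately have "surj f"
    by auto
  then show ?thesis
    using assms by (simp add: bij_def)
qed

text \<open>A real functional \<open>f\<close> with \<open>f x = 1\<close> is the real part of the
  (1,0)-form \<open>f - \<i> (f \<circ> J)\<close>.\<close>

lemma forms_10_separate:
  assumes "linear J" "\<And>x. J (J x) = - x" "x \<noteq> 0"
  obtains \<alpha> where "\<alpha> \<in> forms_10 J" "\<alpha> x \<noteq> 0"
proof -
  have "independent {x}"
    using assms(3) by simp
  then obtain f :: "'a \<Rightarrow> real" where f: "linear f" "f x = 1"
    using linear_independent_extend[of "{x}" "\<lambda>_. 1"] by auto
  define \<alpha> where "\<alpha> y = Complex (f y) (- f (J y))" for y
  have "\<alpha> \<in> forms_10 J"
    unfolding forms_10_def complex_dual_def \<alpha>_def using assms f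
    by (auto intro!: linearI simp: linear_add linear_scale linear_neg complex_eq_iff)
  then show ?thesis
    using that f(2) by (auto simp: \<alpha>_def complex_eq_iff)
qed

text \<open>The forms vanishing at \<open>x\<close> are a subspace. If it contains the coframe, it
  contains all (1,0)-forms, and these separate \<open>x\<close> from 0.\<close>

lemma coframe_properties:
  assumes J: "linear J" "\<And>x. J (J x) = - x"
    and sp: "form.span {\<omega>1, \<omega>2, \<omega>3} = forms_10 J"
  shows "linear \<omega>1" "linear \<omega>2" "linear \<omega>3"
    and "\<And>x. \<omega>1 x = 0 \<Longrightarrow> \<omega>2 x = 0 \<Longrightarrow> \<omega>3 x = 0 \<Longrightarrow> x = 0"
proof -
  have "{\<omega>1, \<omega>2, \<omega>3} \<subseteq> forms_10 J"
    using sp form.span_superset by metis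
  then show "linear \<omega>1" "linear \<omega>2" "linear \<omega>3"
    by (auto simp: forms_10_def complex_dual_def)
next
  fix x assume 0: "\<omega>1 x = 0" "\<omega>2 x = 0" "\<omega>3 x = 0"
  have "forms_10 J \<subseteq> {\<alpha>. \<alpha> x = 0}"
    unfolding sp[symmetric]
    by (intro form.span_minimal) (auto simp: 0 form.subspace_def)
  then show "x = 0"
    using forms_10_separate[OF J] by blast
qed

section \<open>The step criterion and the passage to the model\<close>

theorem proposition2p13:
  fixes br :: "'a::real_vector \<Rightarrow> 'a \<Rightarrow> 'a"
    and J :: "'a \<Rightarrow> 'a"
    and \<omega>1 \<omega>2 \<omega>3 :: "'a \<Rightarrow> complex"
    and \<rho> B C :: complex
  assumes "lie_bracket br"
    and "dim (UNIV :: 'a set) = 6"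
    and "nilpotent_lie br"
    and "complex_structure br J"
    and "distinct [\<omega>1, \<omega>2, \<omega>3]"
    and "form.independent {\<omega>1, \<omega>2, \<omega>3}"
    and "form.span {\<omega>1, \<omega>2, \<omega>3} = forms_10 J"
    and "ce_d br \<omega>1 = (\<lambda>x y. 0)"
    and "ce_d br \<omega>2 = wedge \<omega>1 (conj_form \<omega>1)"
    and "ce_d br \<omega>3 =
           (\<lambda>x y. \<rho> * wedge \<omega>1 \<omega>2 x y
                  + B * wedge \<omega>1 (conj_form \<omega>2) x y
                  + C * wedge \<omega>2 (conj_form \<omega>1) x y)"
    and "\<rho> \<in> {0, 1}"
    and "(\<rho>, B, C) \<noteq> (0, 0, 0)"
  shows "(step_nilpotent 2 br \<longleftrightarrow> B = 1 \<and> \<rho> = 1 \<and> C = 0) \<and>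
         (step_nilpotent 2 br \<longrightarrow>
            lie_isomorphic br h7 \<and>
            (\<forall>J1 J2. complex_structure br J1 \<and> complex_structure br J2 \<longrightarrow>
                     equivalent_structures br J1 J2))"
proof -
  have J: "linear J" "\<And>x. J (J x) = - x"
    using assms(4) unfolding complex_structure_def by blast+
  note cof = coframe_properties[OF J assms(7)]
  note lin_simps = cof(1-3)[THEN linear_0] cof(1-3)[THEN linear_add] cof(1-3)[THEN linear_scale]
    cof(1-3)[THEN linear_diff]
  have "inj (\<lambda>x. (\<omega>1 x, \<omega>2 x, \<omega>3 x))"
  proof (rule injI)
    fix x y assume "(\<omega>1 x, \<omega>2 x, \<omega>3 x) = (\<omega>1 y, \<omega>2 y, \<omega>3 y)"
    then have "x - y = 0"
      by (intro cof(4)) (simp_all add: lin_simps)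
    then show "x = y"
      by simp
  qed
  moreover have "linear (\<lambda>x. (\<omega>1 x, \<omega>2 x, \<omega>3 x))"
    by (rule linearI) (simp_all add: lin_simps)
  ultimately have "surj (\<lambda>x. (\<omega>1 x, \<omega>2 x, \<omega>3 x))"
    using assms(2) by (intro bij_is_surj bij_of_inj_linear_dim_eq) simp_all
  then have ex: "\<exists>x. \<omega>1 x = t" for t
  proof -
    obtain x where "(t, 0, 0) = (\<omega>1 x, \<omega>2 x, \<omega>3 x)"
      using \<open>surj _\<close> by (rule surjE)
    then show ?thesis
      by auto
  qed
  have bil: "bilinear br"
    using assms(1) unfolding lie_bracket_def by blast
  have b1: "\<omega>1 (br x y) = 0" for x y
    using assms(8) by (simp add: ce_d_def fun_eq_iff)
  have b2: "\<omega>2 (br x y) = \<omega>1 y * cnj (\<omega>1 x) - \<omega>1 x * cnj (\<omega>1 y)" for x y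
    using fun_cong[OF fun_cong[OF assms(9)], of x y]
    by (simp add: ce_d_def wedge_def conj_form_def neg_eq_iff_add_eq_0 algebra_simps)
  have b3: "\<omega>3 (br x y) = - (\<rho> * (\<omega>1 x * \<omega>2 y - \<omega>1 y * \<omega>2 x)
      + B * (\<omega>1 x * cnj (\<omega>2 y) - \<omega>1 y * cnj (\<omega>2 x))
      + C * (\<omega>2 x * cnj (\<omega>1 y) - \<omega>2 y * cnj (\<omega>1 x)))" for x y
    using fun_cong[OF fun_cong[OF assms(10)], of x y]
    by (simp add: ce_d_def wedge_def conj_form_def neg_eq_iff_add_eq_0 algebra_simps)
  have b3': "\<omega>3 (br x (br y z)) = (C * cnj (\<omega>1 x) - (\<rho> - B) * \<omega>1 x) * \<omega>2 (br y z)" for x y z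
  proof -
    have "cnj (\<omega>2 (br y z)) = - \<omega>2 (br y z)"
      by (simp add: b2)
    then show ?thesis
      unfolding b3[of x "br y z"] b1 by (simp add: algebra_simps)
  qed
  obtain y z where "\<omega>1 y = 1" "\<omega>1 z = \<i>"
    using ex by metis
  then have yz: "\<omega>2 (br y z) \<noteq> 0"
    by (simp add: b2)
  have step: "step_nilpotent 2 br \<longleftrightarrow> B = 1 \<and> \<rho> = 1 \<and> C = 0"
  proof
    assume "step_nilpotent 2 br"
    then have "\<omega>3 (br x (br y z)) = 0" for x
      by (simp add: step_nilpotent_2_iff[OF bil] lin_simps)
    then have "C * cnj (\<omega>1 x) = (\<rho> - B) * \<omega>1 x" for x
      using yz by (simp add: b3')
    then have *: "C * cnj t = (\<rho> - B) * t" for t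
      using ex[of t] by metis
    \<comment> \<open>The values 1 and \<i> separate the linear from the conjugate-linear
      term.\<close>
    have "C = \<rho> - B" "- C = \<rho> - B"
      using *[of 1] *[of \<i>] by (auto simp: mult.commute[of _ \<i>] simp flip: mult_minus_right)
    then have "C = 0" "\<rho> = B"
      by auto
    \<comment> \<open>The case \<open>\<rho> = 0\<close> would make all three coefficients vanish,
      which is excluded.\<close>
    then show "B = 1 \<and> \<rho> = 1 \<and> C = 0"
      using assms(11,12) by auto
  next
    assume "B = 1 \<and> \<rho> = 1 \<and> C = 0"
    then have "br x (br u v) = 0" for x u v
      by (intro cof(4)) (simp_all add: b3' b1 b2[of x])
    moreover have "br y z \<noteq> 0"
      using yz lin_simps(2) by metis
    ultimately show "step_nilpotent 2 br"
      unfolding step_nilpotent_2_iff[OF bil] by blast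
  qed
  have "lie_isomorphic br h7 \<and>
      (\<forall>J1 J2. complex_structure br J1 \<and> complex_structure br J2 \<longrightarrow> equivalent_structures br J1 J2)"
    if "step_nilpotent 2 br"
  proof -
    have coeffs: "B = 1" "\<rho> = 1" "C = 0"
      using that step by auto
    \<comment> \<open>For these coefficients \<open>d\<omega>1 = 0\<close>,
      \<open>d\<omega>2 = -2\<i> Re \<omega>1 \<and> Im \<omega>1\<close> and
      \<open>d\<omega>3 = 2 \<omega>1 \<and> Re \<omega>2\<close>, with \<and> read as the wedge. So
      \<open>Re \<omega>1\<close>, \<open>Im \<omega>1\<close>, \<open>Re \<omega>2\<close> are
      closed, and the halves and the sign turn the other three coordinates of a bracket into a cross
      product.\<close>
    define F :: "'a \<Rightarrow> (real^3) \<times> (real^3)" where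
      "F x = (vector [Re (\<omega>1 x), Im (\<omega>1 x), Re (\<omega>2 x)],
              vector [- Im (\<omega>3 x) / 2, Re (\<omega>3 x) / 2, Im (\<omega>2 x) / 2])" for x
    have lin: "linear F"
      by (rule linearI) (simp_all add: F_def lin_simps vec_eq_iff forall_3 field_simps)
    have "inj F"
      unfolding linear_injective_0[OF lin]
      by (intro allI impI cof(4))
        (simp_all add: F_def prod_eq_iff vec_eq_iff forall_3 complex_eq_iff)
    then have "bij F"
      using lin assms(2) by (intro bij_of_inj_linear_dim_eq) simp_all
    moreover have "F (br x y) = cross_bracket (F x) (F y)" for x y
      by (simp add: F_def cross_bracket_def cross3_def vec_eq_iff forall_3 b1 b2 b3 coeffs
          field_simps)
    ultimately have F: "lie_iso br cross_bracket F"
      using lin by (simp add: lie_iso_def)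
    show ?thesis
      unfolding lie_isomorphic_def
      using lie_iso_compose[OF F lie_iso_cross_to_h7] equivalent_structures_transport[OF F]
        equivalent_structures_cross_bracket complex_structure_transport[OF F] by blast
  qed
  then show ?thesis
    using step by blast
qed

end
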